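(* Let $\Phi^{(r)}:\mathcal U\subset J^r\pi\to\mathcal U'\subset J^r\pi'$ be a hodograph $k$-contact transformation. If $S\subset\mathcal U$ is a holonomic submanifold of $J^r\pi$ and $\Phi^{(r)}(S)$ is transverse to $\pi'_r:J^r\pi'\to Q'$, then $\Phi^{(r)}(S)$ is a holonomic submanifold of $J^r\pi'$.
   Context: $\pi:E\to Q$, $\pi':E'\to Q'$ are fibred manifolds with $\dim Q=\dim Q'=n$ and the same fibre rank $m$; $r\ge1$. $J^r\pi$ is the $r$-th jet bundle, $\pi_r:J^r\pi\to Q$ the projection, $\mathcal C^r_\pi$ its Cartan distribution (locally the common kernel of $\theta^\alpha_I=du^\alpha_I-\sum_iu^\alpha_{I+\widehat e_i}dx^i$, $|I|\le r-1$). An $n$-dimensional submanifold of $J^r\pi$ is holonomic if locally it is the image $j^r\phi(U)$ of the $r$-jet prolongation of a local section $\phi$ of $\pi$. An $n$-dimensional submanifold $L\subset J^r\pi'$ is transverse to $\pi'_r$ if $TL\cap\ker T\pi'_r=0$. A hodograph-type transformation from $\pi$ to $\pi'$ is a local diffeomorphism $\Phi_0:E\to E'$ sending local graphs of sections of $\pi$, whenever their images are transverse to $\pi'$, into local graphs of sections of $\pi'$. Its $r$-th hodograph prolongation sends $j^r_x\phi$ (in the open set where $\Phi_0(\phi(U))$ is transverse to $\pi'$) to $j^r_{x'}\phi'$, where $\phi'$ is the local section of $\pi'$ whose image is locally $\Phi_0(\phi(U))$ and $x'=\pi'(\Phi_0(\phi(x)))$. A hodograph $k$-contact transformation is a local diffeomorphism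 $\Phi^{(r)}:\mathcal U\subset J^r\pi\to\mathcal U'\subset J^r\pi'$ (between open subsets) with $T\Phi^{(r)}(\mathcal C^r_\pi)=\mathcal C^r_{\pi'}$ and which arises locally from a hodograph-type change of variables in this way. *)

theory Defs
  imports "HOL-Analysis.Analysis" "HOL-Library.Multiset"
begin

section \<open>Smooth functions in coordinates\<close>

text \<open>
  Coordinate spaces are \<open>\<real>\<^sup>I\<close> for a finite index set \<open>I\<close>, that is \<open>I \<rightarrow>\<^sub>E UNIV\<close> with the topology
  \<open>powertop_real I\<close>.  The dimension and the jet order are terms rather than types, because the
  number of fibre coordinates of a jet bundle depends on the order \<open>r\<close>.
\<close>

definition pd :: "'i \<Rightarrow> (('i \<Rightarrow> real) \<Rightarrow> real) \<Rightarrow> ('i \<Rightarrow> real) \<Rightarrow> real" where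
  "pd i f p = deriv (\<lambda>t. f (p(i := t))) (p i)"

definition pds :: "'i list \<Rightarrow> (('i \<Rightarrow> real) \<Rightarrow> real) \<Rightarrow> ('i \<Rightarrow> real) \<Rightarrow> real" where
  "pds is f = foldr pd is f"

text \<open>\<open>f\<close> is \<open>C\<^sup>\<infinity>\<close> on an open set \<open>A \<subseteq> \<real>\<^sup>I\<close>: all iterated partial derivatives exist and are continuous.\<close>

definition smooth_real :: "'i set \<Rightarrow> ('i \<Rightarrow> real) set \<Rightarrow> (('i \<Rightarrow> real) \<Rightarrow> real) \<Rightarrow> bool" where
  "smooth_real I A f \<longleftrightarrow> (\<forall>is. set is \<subseteq> I \<longrightarrow>
     continuous_map (subtopology (powertop_real I) A) euclideanreal (pds is f) \<and>
     (\<forall>i\<in>I. \<forall>p\<in>A. (\<lambda>t. pds is f (p(i := t))) differentiable (at (p i))))"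

definition smooth_coords ::
  "'i set \<Rightarrow> 'j set \<Rightarrow> ('i \<Rightarrow> real) set \<Rightarrow> (('i \<Rightarrow> real) \<Rightarrow> ('j \<Rightarrow> real)) \<Rightarrow> bool" where
  "smooth_coords I J A F \<longleftrightarrow> (\<forall>j\<in>J. smooth_real I A (\<lambda>p. F p j))"

text \<open>The differential of \<open>F : \<real>\<^sup>I \<rightarrow> \<real>\<^sup>J\<close> at \<open>p\<close>, applied to \<open>v\<close>.\<close>

definition jacobian_map ::
  "'i set \<Rightarrow> 'j set \<Rightarrow> (('i \<Rightarrow> real) \<Rightarrow> ('j \<Rightarrow> real)) \<Rightarrow> ('i \<Rightarrow> real) \<Rightarrow> ('i \<Rightarrow> real) \<Rightarrow> ('j \<Rightarrow> real)" where
  "jacobian_map I J F p v = (\<lambda>j\<in>J. \<Sum>i\<in>I. pd i (\<lambda>q. F q j) p * v i)"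


section \<open>Smooth manifolds\<close>

text \<open>A chart is a pair of its domain and its coordinate map.\<close>

type_synonym ('a, 'i) chart = "'a set \<times> ('a \<Rightarrow> 'i \<Rightarrow> real)"

record ('a, 'i) charted =
  mtop :: "'a topology"
  coords :: "'i set"
  atlas :: "('a, 'i) chart set"

definition local_rep ::
  "('a, 'i) chart \<Rightarrow> ('b, 'j) chart \<Rightarrow> ('a \<Rightarrow> 'b) \<Rightarrow> ('i \<Rightarrow> real) \<Rightarrow> ('j \<Rightarrow> real)" where
  "local_rep C D f = snd D \<circ> f \<circ> inv_into (fst C) (snd C)"

definition is_chart :: "('a, 'i) charted \<Rightarrow> ('a, 'i) chart \<Rightarrow> bool" where
  "is_chart M C \<longleftrightarrow> (case C of (U, c) \<Rightarrow>
     openin (mtop M) U \<and> openin (powertop_real (coords M)) (c ` U) \<and>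
     homeomorphic_map (subtopology (mtop M) U) (subtopology (powertop_real (coords M)) (c ` U)) c)"

definition compatible :: "'i set \<Rightarrow> ('a, 'i) chart \<Rightarrow> ('a, 'i) chart \<Rightarrow> bool" where
  "compatible I C D \<longleftrightarrow>
     smooth_coords I I (snd C ` (fst C \<inter> fst D)) (local_rep C D id) \<and>
     smooth_coords I I (snd D ` (fst C \<inter> fst D)) (local_rep D C id)"

text \<open>The maximal atlas.\<close>

definition charts :: "('a, 'i) charted \<Rightarrow> ('a, 'i) chart set" where
  "charts M = {C. is_chart M C \<and> (\<forall>D\<in>atlas M. compatible (coords M) C D)}"

definition smooth_manifold :: "('a, 'i) charted \<Rightarrow> bool" where
  "smooth_manifold M \<longleftrightarrow>
     finite (coords M) \<and> Hausdorff_space (mtop M) \<and> second_countable (mtop M) \<and>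
     (\<Union>C\<in>atlas M. fst C) = topspace (mtop M) \<and> atlas M \<subseteq> charts M"

definition smooth_on ::
  "('a, 'i) charted \<Rightarrow> ('b, 'j) charted \<Rightarrow> 'a set \<Rightarrow> ('a \<Rightarrow> 'b) \<Rightarrow> bool" where
  "smooth_on M N W f \<longleftrightarrow>
     openin (mtop M) W \<and> continuous_map (subtopology (mtop M) W) (mtop N) f \<and>
     (\<forall>C\<in>charts M. \<forall>D\<in>charts N.
        smooth_coords (coords M) (coords N) (snd C ` (W \<inter> fst C \<inter> f -` fst D)) (local_rep C D f))"

text \<open>\<open>f\<close> is defined on the open set \<open>W\<close>; it need not be injective on all of \<open>W\<close>.\<close>

definition local_diffeomorphism_on ::
  "('a, 'i) charted \<Rightarrow> ('b, 'j) charted \<Rightarrow> 'a set \<Rightarrow> ('a \<Rightarrow> 'b) \<Rightarrow> bool" where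
  "local_diffeomorphism_on M N W f \<longleftrightarrow>
     openin (mtop M) W \<and>
     (\<forall>p\<in>W. \<exists>G. openin (mtop M) G \<and> p \<in> G \<and> G \<subseteq> W \<and>
        openin (mtop N) (f ` G) \<and> inj_on f G \<and>
        smooth_on M N G f \<and> smooth_on N M (f ` G) (inv_into G f))"

text \<open>The chart \<open>(U, c)\<close> straightens \<open>L\<close> to the coordinate subspace \<open>\<real>\<^sup>K\<close>.\<close>

definition slice_chart :: "('a, 'i) charted \<Rightarrow> nat \<Rightarrow> 'a set \<Rightarrow> ('a, 'i) chart \<Rightarrow> 'i set \<Rightarrow> bool" where
  "slice_chart M k L C K \<longleftrightarrow>
     C \<in> charts M \<and> K \<subseteq> coords M \<and> card K = k \<and>
     snd C ` (L \<inter> fst C) = {v \<in> snd C ` fst C. \<forall>i\<in>coords M - K. v i = 0}"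

definition submanifold :: "('a, 'i) charted \<Rightarrow> nat \<Rightarrow> 'a set \<Rightarrow> bool" where
  "submanifold M k L \<longleftrightarrow>
     L \<subseteq> topspace (mtop M) \<and> (\<forall>p\<in>L. \<exists>C K. p \<in> fst C \<and> slice_chart M k L C K)"

text \<open>
  \<open>L\<close> is a \<open>k\<close>-dimensional submanifold of \<open>M\<close> with \<open>T\<^sub>pL \<inter> ker T\<^sub>p\<rho> = 0\<close> for all \<open>p \<in> L\<close>.  In a slice
  chart \<open>T\<^sub>pL\<close> is the set of coordinate vectors whose components outside \<open>K\<close> vanish.
\<close>

definition transverse ::
  "('a, 'i) charted \<Rightarrow> ('b, 'j) charted \<Rightarrow> ('a \<Rightarrow> 'b) \<Rightarrow> nat \<Rightarrow> 'a set \<Rightarrow> bool" where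
  "transverse M B \<rho> k L \<longleftrightarrow>
     submanifold M k L \<and>
     (\<forall>p\<in>L. \<forall>C K D. p \<in> fst C \<and> slice_chart M k L C K \<and> D \<in> charts B \<and> \<rho> p \<in> fst D \<longrightarrow>
        (\<forall>v \<in> coords M \<rightarrow>\<^sub>E UNIV.
           (\<forall>i\<in>coords M - K. v i = 0) \<and>
           (\<forall>j\<in>coords B. jacobian_map (coords M) (coords B) (local_rep C D \<rho>) (snd C p) v j = 0) \<longrightarrow>
           (\<forall>i\<in>coords M. v i = 0)))"


section \<open>Fibred manifolds and their local sections\<close>

text \<open>
  The total space is modelled on \<open>\<real>\<^sup>n \<times> \<real>\<^sup>m\<close>, with indices \<open>Inl i\<close> (\<open>i < n\<close>) and \<open>Inr \<alpha>\<close> (\<open>\<alpha> < m\<close>).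
  The charts of its atlas need not be adapted to the projection.
\<close>

record ('q, 'e) fibred =
  base_dim :: nat
  fibre_dim :: nat
  base :: "('q, nat) charted"
  total :: "('e, nat + nat) charted"
  proj :: "'e \<Rightarrow> 'q"

definition fibred_manifold :: "('q, 'e) fibred \<Rightarrow> bool" where
  "fibred_manifold \<pi> \<longleftrightarrow>
     smooth_manifold (base \<pi>) \<and> coords (base \<pi>) = {..<base_dim \<pi>} \<and>
     smooth_manifold (total \<pi>) \<and> coords (total \<pi>) = {..<base_dim \<pi>} <+> {..<fibre_dim \<pi>} \<and>
     smooth_on (total \<pi>) (base \<pi>) (topspace (mtop (total \<pi>))) (proj \<pi>) \<and>
     proj \<pi> ` topspace (mtop (total \<pi>)) = topspace (mtop (base \<pi>)) \<and>
     (\<forall>C\<in>charts (total \<pi>). \<forall>D\<in>charts (base \<pi>). \<forall>e \<in> fst C \<inter> proj \<pi> -` fst D.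
        jacobian_map (coords (total \<pi>)) (coords (base \<pi>)) (local_rep C D (proj \<pi>)) (snd C e)
          ` (coords (total \<pi>) \<rightarrow>\<^sub>E UNIV) = (coords (base \<pi>) \<rightarrow>\<^sub>E UNIV))"

definition local_section :: "('q, 'e) fibred \<Rightarrow> 'q set \<Rightarrow> ('q \<Rightarrow> 'e) \<Rightarrow> bool" where
  "local_section \<pi> V \<phi> \<longleftrightarrow>
     smooth_on (base \<pi>) (total \<pi>) V \<phi> \<and> (\<forall>x\<in>V. proj \<pi> (\<phi> x) = x)"

definition section_near :: "('q, 'e) fibred \<Rightarrow> 'q \<Rightarrow> ('q \<Rightarrow> 'e) \<Rightarrow> bool" where
  "section_near \<pi> x \<phi> \<longleftrightarrow> (\<exists>V. x \<in> V \<and> local_section \<pi> V \<phi>)"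

text \<open>\<open>C\<close> is a chart \<open>(x\<^sup>i, u\<^sup>\<alpha>)\<close> of the total space whose \<open>x\<^sup>i\<close> are the pulled back coordinates of \<open>D\<close>.\<close>

definition adapted :: "('q, 'e) fibred \<Rightarrow> ('e, nat + nat) chart \<Rightarrow> ('q, nat) chart \<Rightarrow> bool" where
  "adapted \<pi> C D \<longleftrightarrow>
     C \<in> charts (total \<pi>) \<and> D \<in> charts (base \<pi>) \<and> proj \<pi> ` fst C \<subseteq> fst D \<and>
     (\<forall>e\<in>fst C. \<forall>i<base_dim \<pi>. snd C e (Inl i) = snd D (proj \<pi> e) i)"


section \<open>Jet bundles\<close>

text \<open>
  A multi-index \<open>I\<close> is a multiset over \<open>{..<n}\<close>, with \<open>\<bar>I\<bar> = size I\<close>; \<open>I + e\<^sub>i\<close> is \<open>add_mset i I\<close>.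
\<close>

definition multi_indices :: "nat \<Rightarrow> nat \<Rightarrow> nat multiset set" where
  "multi_indices n r = {I. set_mset I \<subseteq> {..<n} \<and> size I \<le> r}"

definition section_derivative ::
  "('e, nat + nat) chart \<Rightarrow> ('q, nat) chart \<Rightarrow> ('q \<Rightarrow> 'e) \<Rightarrow> nat \<Rightarrow> nat multiset \<Rightarrow> 'q \<Rightarrow> real" where
  "section_derivative C D \<phi> \<alpha> I x =
     pds (sorted_list_of_multiset I) (\<lambda>p. local_rep D C \<phi> p (Inr \<alpha>)) (snd D x)"

definition same_jet :: "('q, 'e) fibred \<Rightarrow> nat \<Rightarrow> 'q \<Rightarrow> ('q \<Rightarrow> 'e) \<Rightarrow> ('q \<Rightarrow> 'e) \<Rightarrow> bool" where
  "same_jet \<pi> r x \<phi> \<psi> \<longleftrightarrow>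
     \<phi> x = \<psi> x \<and>
     (\<forall>C D. adapted \<pi> C D \<and> \<phi> x \<in> fst C \<longrightarrow>
        (\<forall>\<alpha><fibre_dim \<pi>. \<forall>I\<in>multi_indices (base_dim \<pi>) r.
           section_derivative C D \<phi> \<alpha> I x = section_derivative C D \<psi> \<alpha> I x))"

type_synonym ('q, 'e) jet = "'q \<times> ('q \<Rightarrow> 'e) set"

definition jet :: "('q, 'e) fibred \<Rightarrow> nat \<Rightarrow> ('q \<Rightarrow> 'e) \<Rightarrow> 'q \<Rightarrow> ('q, 'e) jet" where
  "jet \<pi> r \<phi> x = (x, {\<psi>. section_near \<pi> x \<psi> \<and> same_jet \<pi> r x \<phi> \<psi>})"

text \<open>The projection \<open>\<pi>\<^sub>r : J\<^sup>r\<pi> \<rightarrow> Q\<close>.\<close>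

definition jet_proj :: "('q, 'e) jet \<Rightarrow> 'q" where
  "jet_proj = fst"

text \<open>Index \<open>Inl i\<close> is the coordinate \<open>x\<^sup>i\<close>, index \<open>Inr (\<alpha>, I)\<close> the coordinate \<open>u\<^sup>\<alpha>\<^sub>I\<close>.\<close>

definition jet_coords :: "('q, 'e) fibred \<Rightarrow> nat \<Rightarrow> (nat + nat \<times> nat multiset) set" where
  "jet_coords \<pi> r = {..<base_dim \<pi>} <+> ({..<fibre_dim \<pi>} \<times> multi_indices (base_dim \<pi>) r)"

text \<open>
  The coordinates of a jet are read off from an arbitrary representative; by the definition of
  \<open>same_jet\<close> they do not depend on it.
\<close>

definition jet_chart ::
  "('q, 'e) fibred \<Rightarrow> nat \<Rightarrow> ('e, nat + nat) chart \<Rightarrow> ('q, nat) chart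
     \<Rightarrow> (('q, 'e) jet, nat + nat \<times> nat multiset) chart" where
  "jet_chart \<pi> r C D =
     ({jet \<pi> r \<phi> x | \<phi> x. section_near \<pi> x \<phi> \<and> \<phi> x \<in> fst C},
      \<lambda>j. \<lambda>k\<in>jet_coords \<pi> r. case k of
         Inl i \<Rightarrow> snd D (fst j) i
       | Inr (\<alpha>, I) \<Rightarrow> section_derivative C D (SOME \<phi>. \<phi> \<in> snd j) \<alpha> I (fst j))"

definition jet_charts ::
  "('q, 'e) fibred \<Rightarrow> nat \<Rightarrow> (('q, 'e) jet, nat + nat \<times> nat multiset) chart set" where
  "jet_charts \<pi> r = {jet_chart \<pi> r C D | C D. adapted \<pi> C D}"

definition jet_bundle ::
  "('q, 'e) fibred \<Rightarrow> nat \<Rightarrow> (('q, 'e) jet, nat + nat \<times> nat multiset) charted" where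
  "jet_bundle \<pi> r =
     \<lparr> mtop = topology_generated_by
         {{j \<in> fst A. snd A j \<in> G} | A G. A \<in> jet_charts \<pi> r \<and> openin (powertop_real (jet_coords \<pi> r)) G},
       coords = jet_coords \<pi> r,
       atlas = jet_charts \<pi> r \<rparr>"

text \<open>
  The Cartan distribution at the point with jet coordinates \<open>a\<close>: the common kernel of the forms
  \<open>du\<^sup>\<alpha>\<^sub>I - (\<Sum>i. u\<^sup>\<alpha>\<^bsub>I + e\<^sub>i\<^esub> dx\<^sup>i)\<close> with \<open>\<bar>I\<bar> \<le> r - 1\<close>.
\<close>

definition cartan ::
  "('q, 'e) fibred \<Rightarrow> nat \<Rightarrow> (nat + nat \<times> nat multiset \<Rightarrow> real)
     \<Rightarrow> (nat + nat \<times> nat multiset \<Rightarrow> real) set" where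
  "cartan \<pi> r a = {v \<in> jet_coords \<pi> r \<rightarrow>\<^sub>E UNIV.
     \<forall>\<alpha><fibre_dim \<pi>. \<forall>I\<in>multi_indices (base_dim \<pi>) (r - 1).
       v (Inr (\<alpha>, I)) = (\<Sum>i<base_dim \<pi>. a (Inr (\<alpha>, add_mset i I)) * v (Inl i))}"

definition holonomic :: "('q, 'e) fibred \<Rightarrow> nat \<Rightarrow> ('q, 'e) jet set \<Rightarrow> bool" where
  "holonomic \<pi> r S \<longleftrightarrow>
     submanifold (jet_bundle \<pi> r) (base_dim \<pi>) S \<and>
     (\<forall>p\<in>S. \<exists>G V \<phi>. openin (mtop (jet_bundle \<pi> r)) G \<and> p \<in> G \<and>
        local_section \<pi> V \<phi> \<and> S \<inter> G = jet \<pi> r \<phi> ` V)"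


section \<open>Hodograph transformations\<close>

text \<open>
  \<open>\<Phi>\<^sub>0\<close> is defined on an open subset \<open>W\<close> of the total space.  That the image of a local section is
  locally a graph means that every point of its domain has an open neighbourhood whose image is
  the image of a local section of \<open>\<pi>'\<close>.
\<close>

definition hodograph_type ::
  "('q, 'e) fibred \<Rightarrow> ('p, 'f) fibred \<Rightarrow> 'e set \<Rightarrow> ('e \<Rightarrow> 'f) \<Rightarrow> bool" where
  "hodograph_type \<pi> \<pi>' W \<Phi>\<^sub>0 \<longleftrightarrow>
     local_diffeomorphism_on (total \<pi>) (total \<pi>') W \<Phi>\<^sub>0 \<and>
     (\<forall>V \<phi>. local_section \<pi> V \<phi> \<and> \<phi> ` V \<subseteq> W \<and>
        transverse (total \<pi>') (base \<pi>') (proj \<pi>') (base_dim \<pi>') (\<Phi>\<^sub>0 ` \<phi> ` V) \<longrightarrow>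
        (\<forall>x\<in>V. \<exists>V\<^sub>0 V' \<phi>'. openin (mtop (base \<pi>)) V\<^sub>0 \<and> x \<in> V\<^sub>0 \<and> V\<^sub>0 \<subseteq> V \<and>
           local_section \<pi>' V' \<phi>' \<and> \<Phi>\<^sub>0 ` \<phi> ` V\<^sub>0 = \<phi>' ` V'))"

text \<open>
  On \<open>N \<subseteq> J\<^sup>r\<pi>\<close> the map \<open>\<Psi>\<close> is the \<open>r\<close>-th hodograph prolongation of \<open>\<Phi>\<^sub>0\<close>: all jets in \<open>N\<close> belong to the
  set where the prolongation is defined (the image of the represented section is transverse near
  the point in question), and \<open>\<Psi>\<close> sends \<open>j\<^sup>r\<^sub>x\<phi>\<close> to \<open>j\<^sup>r\<^bsub>x'\<^esub>\<phi>'\<close> whenever the image of \<open>\<phi>'\<close> is the image under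
  \<open>\<Phi>\<^sub>0\<close> of the graph of \<open>\<phi>\<close> over a neighbourhood of \<open>x\<close>.
\<close>

definition hodograph_prolongation_on ::
  "('q, 'e) fibred \<Rightarrow> ('p, 'f) fibred \<Rightarrow> nat \<Rightarrow> 'e set \<Rightarrow> ('e \<Rightarrow> 'f) \<Rightarrow> ('q, 'e) jet set
     \<Rightarrow> (('q, 'e) jet \<Rightarrow> ('p, 'f) jet) \<Rightarrow> bool" where
  "hodograph_prolongation_on \<pi> \<pi>' r W \<Phi>\<^sub>0 N \<Psi> \<longleftrightarrow>
     (\<forall>V \<phi> x. local_section \<pi> V \<phi> \<and> x \<in> V \<and> jet \<pi> r \<phi> x \<in> N \<longrightarrow>
        (\<exists>V\<^sub>0. openin (mtop (base \<pi>)) V\<^sub>0 \<and> x \<in> V\<^sub>0 \<and> V\<^sub>0 \<subseteq> V \<and> \<phi> ` V\<^sub>0 \<subseteq> W \<and>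
           transverse (total \<pi>') (base \<pi>') (proj \<pi>') (base_dim \<pi>') (\<Phi>\<^sub>0 ` \<phi> ` V\<^sub>0)) \<and>
        (\<forall>V\<^sub>0 V' \<phi>'. openin (mtop (base \<pi>)) V\<^sub>0 \<and> x \<in> V\<^sub>0 \<and> V\<^sub>0 \<subseteq> V \<and> \<phi> ` V\<^sub>0 \<subseteq> W \<and>
           local_section \<pi>' V' \<phi>' \<and> \<Phi>\<^sub>0 ` \<phi> ` V\<^sub>0 = \<phi>' ` V' \<longrightarrow>
           \<Psi> (jet \<pi> r \<phi> x) = jet \<pi>' r \<phi>' (proj \<pi>' (\<Phi>\<^sub>0 (\<phi> x)))))"

definition hodograph_contact ::
  "('q, 'e) fibred \<Rightarrow> ('p, 'f) fibred \<Rightarrow> nat \<Rightarrow> ('q, 'e) jet set \<Rightarrow> ('p, 'f) jet set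
     \<Rightarrow> (('q, 'e) jet \<Rightarrow> ('p, 'f) jet) \<Rightarrow> bool" where
  "hodograph_contact \<pi> \<pi>' r U U' \<Phi> \<longleftrightarrow>
     openin (mtop (jet_bundle \<pi> r)) U \<and> openin (mtop (jet_bundle \<pi>' r)) U' \<and> \<Phi> ` U \<subseteq> U' \<and>
     local_diffeomorphism_on (jet_bundle \<pi> r) (jet_bundle \<pi>' r) U \<Phi> \<and>
     (\<forall>A\<in>jet_charts \<pi> r. \<forall>B\<in>jet_charts \<pi>' r. \<forall>p \<in> U \<inter> fst A \<inter> \<Phi> -` fst B.
        jacobian_map (jet_coords \<pi> r) (jet_coords \<pi>' r) (local_rep A B \<Phi>) (snd A p)
          ` cartan \<pi> r (snd A p) = cartan \<pi>' r (snd B (\<Phi> p))) \<and>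
     (\<forall>p\<in>U. \<exists>N W \<Phi>\<^sub>0. openin (mtop (jet_bundle \<pi> r)) N \<and> p \<in> N \<and> N \<subseteq> U \<and>
        hodograph_type \<pi> \<pi>' W \<Phi>\<^sub>0 \<and> hodograph_prolongation_on \<pi> \<pi>' r W \<Phi>\<^sub>0 N \<Phi>)"

end

theory Submission
  imports Defs "HOL-Homology.Invariance_of_Domain"
begin

text \<open>
  That \<open>\<Phi> ` S\<close> is a submanifold of dimension \<open>n\<close> is part of transversality, so only the local
  description by jet prolongations is at stake.

  Near a point \<open>p = j\<^sup>r\<^sub>x\<phi>\<close> of \<open>S\<close> the map \<open>\<Phi>\<close> is the prolongation of some \<open>\<Phi>\<^sub>0\<close>.  The transversality
  built into the domain of the prolongation and the defining property of \<open>\<Phi>\<^sub>0\<close> together give a local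
  section \<open>\<phi>'\<close> of \<open>\<pi>'\<close> whose image is \<open>\<Phi>\<^sub>0 (\<phi> (V\<^sub>1))\<close> for a neighbourhood \<open>V\<^sub>1\<close> of \<open>x\<close>.  One and the same \<open>\<phi>'\<close>
  computes \<open>\<Phi>\<close> at all jets \<open>j\<^sup>r\<^sub>y\<phi>\<close> with \<open>y \<in> V\<^sub>1\<close>, hence \<open>\<Phi>\<close> carries the whole prolongation of \<open>\<phi>\<close>
  over \<open>V\<^sub>1\<close> onto the prolongation of \<open>\<phi>'\<close> (lemma \<open>hodograph_prolongation_image\<close>).

  This yields a prolongation through \<open>\<Phi> p\<close> that is contained in \<open>\<Phi> ` S\<close>.  It must also fill out
  \<open>\<Phi> ` S\<close> near \<open>\<Phi> p\<close>, and this does not follow from the description of \<open>S\<close> near \<open>p\<close>: \<open>\<Phi>\<close> need not be injective, so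
  points of \<open>S\<close> far from \<open>p\<close> may be sent close to \<open>\<Phi> p\<close>.  Here the dimension decides.
  The prolongation of \<open>\<phi>'\<close> is a continuous injection of an \<open>n\<close>-dimensional manifold into the
  \<open>n\<close>-dimensional submanifold \<open>\<Phi> ` S\<close>, so its image is open in \<open>\<Phi> ` S\<close> by invariance of domain
  (lemmas \<open>openin_image_in_submanifold\<close> and \<open>holonomicI\<close>).

  Continuity of prolongations (lemma \<open>continuous_map_jet\<close>) enters twice: for this last step, and
  for shrinking the domain of \<open>\<phi>\<close> until its jets stay where \<open>\<Phi>\<close> is the prolongation of \<open>\<Phi>\<^sub>0\<close>.
\<close>

section \<open>Invariance of domain for submanifolds\<close>

lemma powertop_real_homeomorphic_Euclidean_space:
  assumes "finite I"
  shows "powertop_real I homeomorphic_space Euclidean_space (card I)"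
proof -
  obtain b where b: "bij_betw b {..<card I} I"
    using assms ex_bij_betw_nat_finite by (metis atLeast0LessThan)
  define b' where "b' = inv_into {..<card I} b"
  have b'_less: "b' i < card I" and b_b': "b (b' i) = i" if "i \<in> I" for i
    using b that bij_betwE[OF bij_betw_inv_into[OF b]] bij_betw_inv_into_right[OF b]
    by (auto simp: b'_def)
  have b_in: "b k \<in> I" and b'_b: "b' (b k) = k" if "k < card I" for k
    using b that bij_betwE[OF b] bij_betw_inv_into_left[OF b] by (auto simp: b'_def)
  define h where "h = (\<lambda>v::'a \<Rightarrow> real. \<lambda>k. if k < card I then v (b k) else 0)"
  define g where "g = (\<lambda>w::nat \<Rightarrow> real. \<lambda>i\<in>I. w (b' i))"
  have "continuous_map (powertop_real I) (Euclidean_space (card I)) h"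
    unfolding h_def continuous_map_componentwise_Euclidean_space
    by (intro allI impI continuous_map_product_projection b_in)
  moreover have "continuous_map (Euclidean_space (card I)) (powertop_real I) g"
    unfolding continuous_map_componentwise
  proof (intro conjI ballI)
    fix i assume "i \<in> I"
    moreover have "continuous_map (powertop_real UNIV) euclideanreal (\<lambda>w. w (b' i))"
      by (rule continuous_map_product_projection) simp
    ultimately show "continuous_map (Euclidean_space (card I)) euclideanreal (\<lambda>w. g w i)"
      unfolding Euclidean_space_def by (simp add: g_def continuous_map_from_subtopology)
  qed (auto simp: g_def)
  moreover have "g (h v) = v" if "v \<in> topspace (powertop_real I)" for v
    using that by (auto simp: g_def h_def b'_less b_b' PiE_def extensional_def)
  moreover have "h (g w) = w" if "w \<in> topspace (Euclidean_space (card I))" for w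
    using that by (auto simp: g_def h_def b_in b'_b topspace_Euclidean_space not_less)
  ultimately have "homeomorphic_maps (powertop_real I) (Euclidean_space (card I)) h g"
    by (simp add: homeomorphic_maps_def)
  then show ?thesis
    unfolding homeomorphic_space_def by blast
qed

text \<open>
  Brouwer's theorem for \<open>Euclidean_space n\<close>, transported to the coordinate spaces \<open>\<real>\<^sup>I\<close>.
\<close>

lemma invariance_of_domain_powertop_real:
  assumes fin: "finite I" "finite J" and card: "card I = card J"
    and A: "openin (powertop_real I) A"
    and f: "continuous_map (subtopology (powertop_real I) A) (powertop_real J) f"
    and inj: "inj_on f A"
  shows "openin (powertop_real J) (f ` A)"
proof -
  let ?X = "powertop_real I" and ?Y = "powertop_real J" and ?E = "Euclidean_space (card I)"
  obtain h h' where h: "homeomorphic_maps ?X ?E h h'"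
    using powertop_real_homeomorphic_Euclidean_space[OF fin(1)]
    unfolding homeomorphic_space_def by blast
  obtain k k' where k: "homeomorphic_maps ?Y ?E k k'"
    using powertop_real_homeomorphic_Euclidean_space[OF fin(2)] card
    unfolding homeomorphic_space_def by metis
  have AX: "A \<subseteq> topspace ?X"
    using A by (rule openin_subset)
  have fAY: "f ` A \<subseteq> topspace ?Y"
    using continuous_map_image_subset_topspace[OF f] AX by (simp add: inf_absorb2)
  have h'h: "h' (h x) = x" if "x \<in> A" for x
    using h AX that unfolding homeomorphic_maps_def by blast
  have k'k: "k' (k y) = y" if "y \<in> topspace ?Y" for y
    using k that unfolding homeomorphic_maps_def by blast
  have hA: "openin ?E (h ` A)"
    using h A homeomorphic_map_openness_eq homeomorphic_maps_map by blast
  have "continuous_map (subtopology ?E (h ` A)) (subtopology ?X A) h'"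
    using h h'h unfolding homeomorphic_maps_def
    by (auto simp: continuous_map_in_subtopology intro: continuous_map_from_subtopology)
  then have "continuous_map (subtopology ?E (h ` A)) ?E (k \<circ> (f \<circ> h'))"
    using f k unfolding homeomorphic_maps_def by (metis continuous_map_compose)
  moreover have "inj_on (k \<circ> (f \<circ> h')) (h ` A)"
  proof (rule inj_onI, clarsimp)
    fix x y assume xy: "x \<in> A" "y \<in> A" and "k (f (h' (h x))) = k (f (h' (h y)))"
    then have "k (f x) = k (f y)"
      by (simp add: h'h)
    then have "f x = f y"
      using k'k xy fAY by (metis image_subset_iff)
    then show "h x = h y"
      using inj_onD[OF inj] xy by blast
  qed
  ultimately have "openin ?E ((k \<circ> (f \<circ> h')) ` h ` A)"
    using invariance_of_domain_Euclidean_space[OF hA] by blast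
  moreover have "(k \<circ> (f \<circ> h')) ` h ` A = k ` f ` A"
    by (force simp: h'h image_image)
  ultimately have "openin ?E (k ` f ` A)"
    by simp
  then show ?thesis
    using homeomorphic_map_openness[OF _ fAY] k by (auto simp: homeomorphic_maps_map)
qed

text \<open>
  Any continuous injection into a submanifold of the same dimension has relatively open image: in a
  slice chart it becomes a continuous injection between open subsets of Euclidean spaces.
\<close>

lemma openin_image_in_submanifold:
  fixes B :: "('b, 'i) charted" and M :: "('a, 'j) charted"
  assumes B: "smooth_manifold B" and finM: "finite (coords M)"
    and L: "submanifold M (card (coords B)) L"
    and V: "openin (mtop B) V"
    and f: "continuous_map (subtopology (mtop B) V) (mtop M) f"
    and inj: "inj_on f V" and fV: "f ` V \<subseteq> L"
  shows "openin (subtopology (mtop M) L) (f ` V)"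
proof (subst openin_subopen, rule ballI)
  fix y assume "y \<in> f ` V"
  then obtain x where x: "x \<in> V" "y = f x" by blast
  obtain D where D: "D \<in> atlas B" "x \<in> fst D"
    using B x(1) openin_subset[OF V] unfolding smooth_manifold_def by blast
  obtain W d where D_eq: "D = (W, d)" by force
  have "is_chart B (W, d)"
    using B D D_eq unfolding smooth_manifold_def charts_def by auto
  then have W: "openin (mtop B) W" and dW: "openin (powertop_real (coords B)) (d ` W)"
    and d: "homeomorphic_map (subtopology (mtop B) W) (subtopology (powertop_real (coords B)) (d ` W)) d"
    by (auto simp: is_chart_def)
  obtain C K where C: "y \<in> fst C" and slice: "slice_chart M (card (coords B)) L C K"
    using L fV \<open>y \<in> f ` V\<close> unfolding submanifold_def by blast
  obtain Z c where C_eq: "C = (Z, c)" by force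
  have K: "K \<subseteq> coords M" "card K = card (coords B)"
    and cL: "c ` (L \<inter> Z) = {v \<in> c ` Z. \<forall>i\<in>coords M - K. v i = 0}"
    using slice by (auto simp: slice_chart_def C_eq)
  have "is_chart M (Z, c)"
    using slice by (auto simp: slice_chart_def charts_def C_eq)
  then have Z: "openin (mtop M) Z"
    and c: "homeomorphic_map (subtopology (mtop M) Z) (subtopology (powertop_real (coords M)) (c ` Z)) c"
    by (auto simp: is_chart_def)
  define V1 where "V1 = W \<inter> {x \<in> V. f x \<in> Z}"
  have V1: "openin (mtop B) V1"
  proof -
    have "openin (subtopology (mtop B) V) {x \<in> topspace (subtopology (mtop B) V). f x \<in> Z}"
      using f Z by (rule openin_continuous_map_preimage)
    moreover have "topspace (subtopology (mtop B) V) = V"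
      using openin_subset[OF V] by (simp add: inf_absorb2)
    ultimately have "openin (mtop B) {x \<in> V. f x \<in> Z}"
      using V openin_trans_full by fastforce
    then show ?thesis
      using W by (simp add: V1_def openin_Int)
  qed
  have V1_sub: "V1 \<subseteq> W" "V1 \<subseteq> V" "f ` V1 \<subseteq> Z"
    by (auto simp: V1_def)
  have topW: "topspace (subtopology (mtop B) W) = W"
    using openin_subset[OF W] by (simp add: inf_absorb2)
  have topZ: "topspace (subtopology (mtop M) Z) = Z"
    using openin_subset[OF Z] by (simp add: inf_absorb2)
  have inj_d: "inj_on d W" and inj_c: "inj_on c Z"
    using homeomorphic_imp_injective_map[OF d] homeomorphic_imp_injective_map[OF c] topW topZ by auto
  let ?A = "d ` V1"
  have A: "openin (powertop_real (coords B)) ?A"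
  proof -
    have "openin (subtopology (mtop B) W) V1"
      using V1 V1_sub(1) by (metis openin_open_subtopology W)
    then have "openin (subtopology (powertop_real (coords B)) (d ` W)) ?A"
      using d V1_sub(1) topW homeomorphic_map_openness by metis
    then show ?thesis
      using dW openin_trans_full by blast
  qed
  obtain e where de: "homeomorphic_maps (subtopology (mtop B) W) (subtopology (powertop_real (coords B)) (d ` W)) d e"
    using d homeomorphic_map_maps by blast
  have ed: "e (d u) = u" if "u \<in> W" for u
    using de that topW unfolding homeomorphic_maps_def by blast
  define F where "F = (\<lambda>a. restrict (c (f (e a))) K)"
  have F: "continuous_map (subtopology (powertop_real (coords B)) ?A) (powertop_real K) F"
  proof -
    have "continuous_map (subtopology (powertop_real (coords B)) (d ` W)) (mtop B) e"
      using de unfolding homeomorphic_maps_def by (simp add: continuous_map_in_subtopology)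
    then have "continuous_map (subtopology (powertop_real (coords B)) ?A) (mtop B) e"
      using V1_sub(1) by (meson continuous_map_from_subtopology_mono image_mono)
    moreover have "e ` ?A \<subseteq> V1"
      using ed V1_sub(1) by auto
    ultimately have e: "continuous_map (subtopology (powertop_real (coords B)) ?A) (subtopology (mtop B) V1) e"
      by (auto simp: continuous_map_in_subtopology)
    have "continuous_map (subtopology (mtop B) V1) (subtopology (mtop M) Z) f"
      using f V1_sub by (auto simp: continuous_map_in_subtopology intro: continuous_map_from_subtopology_mono)
    moreover have "continuous_map (subtopology (mtop M) Z) (powertop_real (coords M)) c"
      using homeomorphic_imp_continuous_map[OF c] by (simp add: continuous_map_in_subtopology)
    ultimately have "continuous_map (subtopology (powertop_real (coords B)) ?A) (powertop_real (coords M)) (c \<circ> (f \<circ> e))"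
      by (intro continuous_map_compose[OF continuous_map_compose[OF e]])
    then have "continuous_map (subtopology (powertop_real (coords B)) ?A) euclideanreal (\<lambda>a. c (f (e a)) i)"
      if "i \<in> coords M" for i
      using that by (simp add: continuous_map_componentwise)
    then show ?thesis
      using K(1) by (auto simp: F_def continuous_map_componentwise)
  qed
  \<comment> \<open>On the slice the coordinates outside \<open>K\<close> vanish, so the coordinates in \<open>K\<close> determine the point.\<close>
  have slice_eq: "j = j'" if j: "j \<in> L \<inter> Z" "j' \<in> L \<inter> Z" and eq: "restrict (c j) K = restrict (c j') K" for j j'
  proof -
    have "c j i = c j' i" for i
    proof (cases "i \<in> coords M")
      case True
      have "c j \<in> {v \<in> c ` Z. \<forall>i\<in>coords M - K. v i = 0}" "c j' \<in> {v \<in> c ` Z. \<forall>i\<in>coords M - K. v i = 0}"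
        unfolding cL[symmetric] using j by auto
      then show ?thesis
        using eq True by (cases "i \<in> K") (auto dest: fun_cong[where x = i])
    next
      case False
      have "c ` Z \<subseteq> topspace (powertop_real (coords M))"
        using homeomorphic_imp_surjective_map[OF c] topZ by auto
      then have "c j \<in> extensional (coords M)" "c j' \<in> extensional (coords M)"
        using j by (auto simp: PiE_def)
      then show ?thesis
        using False by (simp add: extensional_def)
    qed
    then have "c j = c j'" by auto
    then show ?thesis
      using inj_c j by (auto dest: inj_onD)
  qed
  have inL: "f u \<in> L \<inter> Z" if "u \<in> V1" for u
    using that fV V1_sub by auto
  have injF: "inj_on F ?A"
  proof (rule inj_onI, clarify)
    fix u u' assume u: "u \<in> V1" "u' \<in> V1" and "F (d u) = F (d u')"
    then have "restrict (c (f u)) K = restrict (c (f u')) K"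
      using ed V1_sub(1) by (simp add: F_def subset_iff)
    then have "f u = f u'"
      using slice_eq inL u by blast
    then show "d u = d u'"
      using inj u V1_sub(2) by (auto dest: inj_onD)
  qed
  have "openin (powertop_real K) (F ` ?A)"
    using invariance_of_domain_powertop_real[OF _ _ _ A F injF] B K finM
    by (auto simp: smooth_manifold_def intro: finite_subset)
  then have FA: "openin (powertop_real K) ((\<lambda>u. restrict (c (f u)) K) ` V1)"
    using ed V1_sub(1) by (simp add: F_def image_image subset_iff cong: image_cong_simp)
  \<comment> \<open>The open set that cuts \<open>f ` V1\<close> out of \<open>L\<close>: only the slice coordinates \<open>K\<close> are constrained.\<close>
  define T where "T = {j \<in> Z. restrict (c j) K \<in> (\<lambda>u. restrict (c (f u)) K) ` V1}"
  have T: "openin (mtop M) T"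
  proof -
    have "continuous_map (subtopology (mtop M) Z) (powertop_real (coords M)) c"
      using homeomorphic_imp_continuous_map[OF c] by (simp add: continuous_map_in_subtopology)
    then have "continuous_map (subtopology (mtop M) Z) (powertop_real K) (\<lambda>j. restrict (c j) K)"
      using K(1) by (auto simp: continuous_map_componentwise)
    from openin_continuous_map_preimage[OF this FA]
    have "openin (subtopology (mtop M) Z) T"
      by (simp only: T_def topZ)
    then show ?thesis
      using Z openin_trans_full by blast
  qed
  have LT: "L \<inter> T = f ` V1"
  proof
    show "L \<inter> T \<subseteq> f ` V1"
    proof
      fix j assume "j \<in> L \<inter> T"
      then obtain u where "j \<in> L \<inter> Z" "u \<in> V1" "restrict (c j) K = restrict (c (f u)) K"
        by (auto simp: T_def)
      then show "j \<in> f ` V1"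
        using slice_eq inL by blast
    qed
    show "f ` V1 \<subseteq> L \<inter> T"
      using inL by (auto simp: T_def)
  qed
  have "openin (subtopology (mtop M) L) (f ` V1)"
    unfolding LT[symmetric] using T by (rule openin_subtopology_Int2)
  moreover have "y \<in> f ` V1"
    using x D C by (auto simp: V1_def D_eq C_eq)
  ultimately show "\<exists>T. openin (subtopology (mtop M) L) T \<and> y \<in> T \<and> T \<subseteq> f ` V"
    using V1_sub(2) by blast
qed


section \<open>Continuity of jet prolongations\<close>

lemma smooth_real_subset:
  assumes "smooth_real I A f" "A' \<subseteq> A"
  shows "smooth_real I A' f"
  using assms unfolding smooth_real_def
  by (meson continuous_map_from_subtopology_mono subset_iff)

lemma smooth_on_subset:
  assumes "smooth_on M N W f" "openin (mtop M) W'" "W' \<subseteq> W"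
  shows "smooth_on M N W' f"
proof -
  have "smooth_coords (coords M) (coords N) (snd C ` (W' \<inter> fst C \<inter> f -` fst D)) (local_rep C D f)"
    if "C \<in> charts M" "D \<in> charts N" for C D
  proof -
    have "snd C ` (W' \<inter> fst C \<inter> f -` fst D) \<subseteq> snd C ` (W \<inter> fst C \<inter> f -` fst D)"
      using assms(3) by blast
    then show ?thesis
      using assms(1) that smooth_real_subset unfolding smooth_on_def smooth_coords_def by blast
  qed
  then show ?thesis
    using assms unfolding smooth_on_def by (meson continuous_map_from_subtopology_mono)
qed

lemma local_section_subset:
  assumes "local_section \<pi> V \<phi>" "openin (mtop (base \<pi>)) V'" "V' \<subseteq> V"
  shows "local_section \<pi> V' \<phi>"
  using assms smooth_on_subset unfolding local_section_def by blast

lemma jet_eqD: "jet \<pi> r \<phi> x = jet \<pi> r \<psi> y \<Longrightarrow> x = y"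
  by (simp add: jet_def)

lemma same_jet_refl: "same_jet \<pi> r x \<phi> \<phi>"
  by (simp add: same_jet_def)

text \<open>
  A jet is an equivalence class, so its value has to be read off from membership: \<open>\<phi>\<close> represents its
  own jet, and it does so only if it is a section near \<open>x\<close>.
\<close>

lemma jet_eq_imp_value_eq:
  assumes "jet \<pi> r \<phi> x = jet \<pi> r \<psi> x" "section_near \<pi> x \<phi>"
  shows "\<phi> x = \<psi> x"
proof -
  have "\<phi> \<in> snd (jet \<pi> r \<psi> x)"
    using assms(2) unfolding assms(1)[symmetric] by (simp add: jet_def same_jet_refl)
  then show ?thesis
    by (simp add: jet_def same_jet_def)
qed

lemma jet_in_jet_chart_iff:
  assumes "section_near \<pi> x \<phi>"
  shows "jet \<pi> r \<phi> x \<in> fst (jet_chart \<pi> r C D) \<longleftrightarrow> \<phi> x \<in> fst C"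
proof
  assume "jet \<pi> r \<phi> x \<in> fst (jet_chart \<pi> r C D)"
  then obtain \<psi> y where "jet \<pi> r \<phi> x = jet \<pi> r \<psi> y" "\<psi> y \<in> fst C"
    by (auto simp: jet_chart_def)
  then show "\<phi> x \<in> fst C"
    using assms jet_eq_imp_value_eq jet_eqD by metis
next
  assume "\<phi> x \<in> fst C"
  then show "jet \<pi> r \<phi> x \<in> fst (jet_chart \<pi> r C D)"
    using assms by (auto simp: jet_chart_def)
qed

text \<open>
  The representative selected by \<open>jet_chart\<close> may be replaced by \<open>\<phi>\<close>, since \<open>same_jet\<close> compares the
  derivatives in all adapted charts around the value.
\<close>

lemma jet_chart_coordinates:
  assumes "section_near \<pi> x \<phi>" "adapted \<pi> C D" "\<phi> x \<in> fst C"
  shows "snd (jet_chart \<pi> r C D) (jet \<pi> r \<phi> x) =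
    (\<lambda>k\<in>jet_coords \<pi> r. case k of Inl i \<Rightarrow> snd D x i | Inr (\<alpha>, I) \<Rightarrow> section_derivative C D \<phi> \<alpha> I x)"
proof -
  define \<psi> where "\<psi> = (SOME \<psi>. \<psi> \<in> snd (jet \<pi> r \<phi> x))"
  have "\<phi> \<in> snd (jet \<pi> r \<phi> x)"
    using assms(1) by (simp add: jet_def same_jet_refl)
  then have "\<psi> \<in> snd (jet \<pi> r \<phi> x)"
    unfolding \<psi>_def by (rule someI[of "\<lambda>\<psi>. \<psi> \<in> snd (jet \<pi> r \<phi> x)"])
  then have "same_jet \<pi> r x \<phi> \<psi>"
    by (simp add: jet_def)
  then have "section_derivative C D \<psi> \<alpha> I x = section_derivative C D \<phi> \<alpha> I x"
    if "\<alpha> < fibre_dim \<pi>" "I \<in> multi_indices (base_dim \<pi>) r" for \<alpha> I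
    using assms that unfolding same_jet_def by metis
  moreover have "fst (jet \<pi> r \<phi> x) = x"
    by (simp add: jet_def)
  ultimately show ?thesis
    by (auto simp: jet_chart_def \<psi>_def[symmetric] jet_coords_def split: sum.splits intro!: restrict_ext)
qed

lemma continuous_map_chart:
  assumes "D \<in> charts M"
  shows "continuous_map (subtopology (mtop M) (fst D)) (powertop_real (coords M)) (snd D)"
  using assms homeomorphic_imp_continuous_map
  by (fastforce simp: charts_def is_chart_def continuous_map_in_subtopology split: prod.splits)

lemma adapted_section_domain:
  assumes "local_section \<pi> V \<phi>" "adapted \<pi> C D"
  shows "{x \<in> V. \<phi> x \<in> fst C} \<subseteq> fst D"
proof
  fix x assume x: "x \<in> {x \<in> V. \<phi> x \<in> fst C}"
  then have "proj \<pi> (\<phi> x) \<in> fst D"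
    using assms(2) unfolding adapted_def by blast
  then show "x \<in> fst D"
    using assms(1) x by (simp add: local_section_def)
qed

lemma continuous_map_section_derivative:
  assumes \<pi>: "fibred_manifold \<pi>" and \<phi>: "local_section \<pi> V \<phi>" and CD: "adapted \<pi> C D"
    and "\<alpha> < fibre_dim \<pi>" and I: "set_mset I \<subseteq> {..<base_dim \<pi>}"
  shows "continuous_map (subtopology (mtop (base \<pi>)) {x \<in> V. \<phi> x \<in> fst C}) euclideanreal
           (section_derivative C D \<phi> \<alpha> I)"
proof -
  let ?B = "base \<pi>" and ?W = "{x \<in> V. \<phi> x \<in> fst C}"
  let ?P = "snd D ` (V \<inter> fst D \<inter> \<phi> -` fst C)"
  have D: "D \<in> charts ?B" and C: "C \<in> charts (total \<pi>)"
    using CD by (auto simp: adapted_def)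
  have WD: "?W \<subseteq> fst D"
    using \<phi> CD by (rule adapted_section_domain)
  have "smooth_coords (coords ?B) (coords (total \<pi>)) ?P (local_rep D C \<phi>)"
    using \<phi> D C by (simp add: local_section_def smooth_on_def)
  then have "smooth_real (coords ?B) ?P (\<lambda>p. local_rep D C \<phi> p (Inr \<alpha>))"
    using \<pi> assms(4) by (auto simp: fibred_manifold_def smooth_coords_def)
  moreover have "set (sorted_list_of_multiset I) \<subseteq> coords ?B"
    using I \<pi> by (simp add: fibred_manifold_def)
  ultimately have pds: "continuous_map (subtopology (powertop_real (coords ?B)) ?P) euclideanreal
      (pds (sorted_list_of_multiset I) (\<lambda>p. local_rep D C \<phi> p (Inr \<alpha>)))"
    by (simp add: smooth_real_def)
  have "continuous_map (subtopology (mtop ?B) ?W) (powertop_real (coords ?B)) (snd D)"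
    using continuous_map_chart[OF D] WD by (rule continuous_map_from_subtopology_mono)
  moreover have "snd D ` ?W \<subseteq> ?P"
    using WD by blast
  ultimately have "continuous_map (subtopology (mtop ?B) ?W) (subtopology (powertop_real (coords ?B)) ?P) (snd D)"
    by (auto simp: continuous_map_in_subtopology)
  from continuous_map_compose[OF this pds] show ?thesis
    by (simp add: section_derivative_def[abs_def] o_def)
qed

text \<open>
  In a jet chart the prolongation is given by the base coordinates and the partial derivatives of
  \<open>\<phi>\<close>, all of which are continuous.  The jet topology is generated by charts built from adapted
  charts, so a jet belongs to its topological space exactly when some adapted chart surrounds the
  value of the section; for jets on a submanifold of the jet bundle this is automatic.
\<close>

lemma continuous_map_jet:
  assumes \<pi>: "fibred_manifold \<pi>" and \<phi>: "local_section \<pi> V \<phi>"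
    and top: "jet \<pi> r \<phi> ` V \<subseteq> topspace (mtop (jet_bundle \<pi> r))"
  shows "continuous_map (subtopology (mtop (base \<pi>)) V) (mtop (jet_bundle \<pi> r)) (jet \<pi> r \<phi>)"
proof -
  let ?B = "base \<pi>"
  let ?\<S> = "{{j \<in> fst A. snd A j \<in> G} | A G. A \<in> jet_charts \<pi> r \<and> openin (powertop_real (jet_coords \<pi> r)) G}"
  have V: "openin (mtop ?B) V"
    using \<phi> by (simp add: local_section_def smooth_on_def)
  have topV: "topspace (subtopology (mtop ?B) V) = V"
    using openin_subset[OF V] by (simp add: inf_absorb2)
  have near: "section_near \<pi> x \<phi>" if "x \<in> V" for x
    using \<phi> that by (auto simp: section_near_def)
  have "openin (subtopology (mtop ?B) V) (jet \<pi> r \<phi> -` O' \<inter> topspace (subtopology (mtop ?B) V))"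
    if O'_in: "O' \<in> ?\<S>" for O'
  proof -
    from O'_in obtain C D G where CD: "adapted \<pi> C D" and G: "openin (powertop_real (jet_coords \<pi> r)) G"
      and O': "O' = {j \<in> fst (jet_chart \<pi> r C D). snd (jet_chart \<pi> r C D) j \<in> G}"
      unfolding jet_charts_def by blast
    let ?W = "{x \<in> V. \<phi> x \<in> fst C}"
    let ?h = "\<lambda>x. \<lambda>k\<in>jet_coords \<pi> r. case k of Inl i \<Rightarrow> snd D x i
                                     | Inr (\<alpha>, I) \<Rightarrow> section_derivative C D \<phi> \<alpha> I x"
    have D: "D \<in> charts ?B" and C: "C \<in> charts (total \<pi>)"
      using CD by (auto simp: adapted_def)
    have WD: "?W \<subseteq> fst D"
      using \<phi> CD by (rule adapted_section_domain)
    have "openin (mtop (total \<pi>)) (fst C)"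
      using C by (auto simp: charts_def is_chart_def)
    moreover have "continuous_map (subtopology (mtop ?B) V) (mtop (total \<pi>)) \<phi>"
      using \<phi> by (simp add: local_section_def smooth_on_def)
    ultimately have W: "openin (subtopology (mtop ?B) V) ?W"
      using openin_continuous_map_preimage topV by fastforce
    have WB: "openin (mtop ?B) ?W"
      using W V openin_trans_full by blast
    have Dc: "continuous_map (subtopology (mtop ?B) ?W) (powertop_real (coords ?B)) (snd D)"
      using continuous_map_chart[OF D] WD by (rule continuous_map_from_subtopology_mono)
    have "continuous_map (subtopology (mtop ?B) ?W) (powertop_real (jet_coords \<pi> r)) ?h"
      unfolding continuous_map_componentwise
    proof (intro conjI ballI)
      fix k assume k: "k \<in> jet_coords \<pi> r"
      show "continuous_map (subtopology (mtop ?B) ?W) euclideanreal (\<lambda>x. ?h x k)"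
      proof (cases k)
        case (Inl i)
        then have "i \<in> coords ?B"
          using k \<pi> by (auto simp: jet_coords_def fibred_manifold_def)
        then show ?thesis
          using Dc k Inl by (simp add: continuous_map_componentwise)
      next
        case (Inr q)
        then obtain \<alpha> I where q: "k = Inr (\<alpha>, I)" by force
        then have "\<alpha> < fibre_dim \<pi>" "set_mset I \<subseteq> {..<base_dim \<pi>}"
          using k by (auto simp: jet_coords_def multi_indices_def)
        from continuous_map_section_derivative[OF \<pi> \<phi> CD this] show ?thesis
          using k q by simp
      qed
    qed auto
    from openin_continuous_map_preimage[OF this G]
    have "openin (subtopology (mtop ?B) ?W) {x \<in> ?W. ?h x \<in> G}"
      using openin_subset[OF WB] by (simp add: inf_absorb2)
    moreover have "{x \<in> ?W. ?h x \<in> G} = jet \<pi> r \<phi> -` O' \<inter> topspace (subtopology (mtop ?B) V)"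
      unfolding topV O'
    proof (rule Set.set_eqI)
      fix x
      have "jet \<pi> r \<phi> x \<in> fst (jet_chart \<pi> r C D) \<longleftrightarrow> \<phi> x \<in> fst C" if "x \<in> V"
        using jet_in_jet_chart_iff[OF near[OF that]] .
      moreover have "snd (jet_chart \<pi> r C D) (jet \<pi> r \<phi> x) = ?h x" if "x \<in> V" "\<phi> x \<in> fst C"
        using jet_chart_coordinates[OF near[OF that(1)] CD that(2)] .
      ultimately show "x \<in> {x \<in> ?W. ?h x \<in> G} \<longleftrightarrow>
        x \<in> jet \<pi> r \<phi> -` {j \<in> fst (jet_chart \<pi> r C D). snd (jet_chart \<pi> r C D) j \<in> G} \<inter> V"
        by (cases "x \<in> V \<and> \<phi> x \<in> fst C") auto
    qed
    ultimately show ?thesis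
      using openin_trans_full[OF _ WB] topV
      by (metis (no_types, lifting) V inf.cobounded2 openin_open_subtopology)
  qed
  moreover have "jet \<pi> r \<phi> ` topspace (subtopology (mtop ?B) V) \<subseteq> \<Union> ?\<S>"
    using top unfolding topV jet_bundle_def by simp
  ultimately show ?thesis
    unfolding jet_bundle_def by (simp only: charted.simps continuous_on_generated_topo)
qed


section \<open>Holonomic submanifolds\<close>

lemma finite_multi_indices: "finite (multi_indices n r)"
proof -
  have "multi_indices n r = (\<Union>k\<le>r. multisets_of_size {..<n} k)"
    by (auto simp: multi_indices_def multisets_of_size_def)
  then show ?thesis
    by auto
qed

text \<open>
  On a submanifold of dimension \<open>n\<close> it suffices to find through each point a prolongation contained
  in the submanifold: it then coincides with the submanifold near that point, because its image is
  relatively open.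
\<close>

lemma holonomicI:
  assumes \<pi>: "fibred_manifold \<pi>" and L: "submanifold (jet_bundle \<pi> r) (base_dim \<pi>) L"
    and ex: "\<And>p. p \<in> L \<Longrightarrow> \<exists>V \<phi>. local_section \<pi> V \<phi> \<and> p \<in> jet \<pi> r \<phi> ` V \<and> jet \<pi> r \<phi> ` V \<subseteq> L"
  shows "holonomic \<pi> r L"
  unfolding holonomic_def
proof (intro conjI ballI L)
  fix p assume "p \<in> L"
  then obtain V \<phi> where \<phi>: "local_section \<pi> V \<phi>" and p: "p \<in> jet \<pi> r \<phi> ` V"
    and sub: "jet \<pi> r \<phi> ` V \<subseteq> L"
    using ex by blast
  have "jet \<pi> r \<phi> ` V \<subseteq> topspace (mtop (jet_bundle \<pi> r))"
    using sub L unfolding submanifold_def by blast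
  then have cont: "continuous_map (subtopology (mtop (base \<pi>)) V) (mtop (jet_bundle \<pi> r)) (jet \<pi> r \<phi>)"
    using continuous_map_jet[OF \<pi> \<phi>] by blast
  have "openin (subtopology (mtop (jet_bundle \<pi> r)) L) (jet \<pi> r \<phi> ` V)"
  proof (rule openin_image_in_submanifold[OF _ _ _ _ cont _ sub])
    show "smooth_manifold (base \<pi>)"
      using \<pi> by (simp add: fibred_manifold_def)
    show "finite (coords (jet_bundle \<pi> r))"
      by (simp add: jet_bundle_def jet_coords_def finite_multi_indices)
    show "submanifold (jet_bundle \<pi> r) (card (coords (base \<pi>))) L"
      using L \<pi> by (simp add: fibred_manifold_def)
    show "openin (mtop (base \<pi>)) V"
      using \<phi> by (simp add: local_section_def smooth_on_def)
    show "inj_on (jet \<pi> r \<phi>) V"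
      by (auto simp: inj_on_def dest: jet_eqD)
  qed
  then obtain G where "openin (mtop (jet_bundle \<pi> r)) G" "jet \<pi> r \<phi> ` V = G \<inter> L"
    by (auto simp: openin_subtopology)
  then show "\<exists>G V \<phi>. openin (mtop (jet_bundle \<pi> r)) G \<and> p \<in> G \<and> local_section \<pi> V \<phi> \<and> L \<inter> G = jet \<pi> r \<phi> ` V"
    using p \<phi> by (metis Int_commute IntD1)
qed


section \<open>Images under hodograph prolongations\<close>

text \<open>
  The prolongation is defined jet by jet, each time with a section \<open>\<phi>'\<close> of its own.  The definition
  allows any neighbourhood of the point in question, and \<open>V\<^sub>1\<close> is one for each of its points; so a
  single \<open>\<phi>'\<close> serves for all of \<open>V\<^sub>1\<close>.
\<close>

lemma hodograph_prolongation_image: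
  assumes hod: "hodograph_type \<pi> \<pi>' W \<Phi>\<^sub>0"
    and prol: "hodograph_prolongation_on \<pi> \<pi>' r W \<Phi>\<^sub>0 N \<Psi>"
    and \<phi>: "local_section \<pi> V \<phi>" and x: "x \<in> V" and N: "jet \<pi> r \<phi> ` V \<subseteq> N"
  obtains V\<^sub>1 V' \<phi>' where "x \<in> V\<^sub>1" "V\<^sub>1 \<subseteq> V" "local_section \<pi>' V' \<phi>'"
    "\<Psi> ` jet \<pi> r \<phi> ` V\<^sub>1 = jet \<pi>' r \<phi>' ` V'"
proof -
  have mem: "jet \<pi> r \<phi> y \<in> N" if "y \<in> V" for y
    using N that by blast
  note prol_at = prol[unfolded hodograph_prolongation_on_def, THEN spec, THEN spec, THEN spec, THEN mp,
    OF conjI[OF \<phi> conjI[OF _ mem]]]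
  obtain V\<^sub>0 where V\<^sub>0: "openin (mtop (base \<pi>)) V\<^sub>0" "x \<in> V\<^sub>0" "V\<^sub>0 \<subseteq> V" "\<phi> ` V\<^sub>0 \<subseteq> W"
    and tr: "transverse (total \<pi>') (base \<pi>') (proj \<pi>') (base_dim \<pi>') (\<Phi>\<^sub>0 ` \<phi> ` V\<^sub>0)"
    using conjunct1[OF prol_at[OF x x]] by blast
  have "local_section \<pi> V\<^sub>0 \<phi>"
    using \<phi> V\<^sub>0 local_section_subset by blast
  then obtain V\<^sub>1 V' \<phi>' where V\<^sub>1: "openin (mtop (base \<pi>)) V\<^sub>1" "x \<in> V\<^sub>1" "V\<^sub>1 \<subseteq> V\<^sub>0"
    and \<phi>': "local_section \<pi>' V' \<phi>'" and im: "\<Phi>\<^sub>0 ` \<phi> ` V\<^sub>1 = \<phi>' ` V'"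
    using hod tr V\<^sub>0 unfolding hodograph_type_def by blast
  have "\<Psi> (jet \<pi> r \<phi> y) = jet \<pi>' r \<phi>' (proj \<pi>' (\<Phi>\<^sub>0 (\<phi> y)))" if "y \<in> V\<^sub>1" for y
  proof -
    have "y \<in> V" "V\<^sub>1 \<subseteq> V" "\<phi> ` V\<^sub>1 \<subseteq> W"
      using that V\<^sub>0 V\<^sub>1 by auto
    then show ?thesis
      using conjunct2[OF prol_at[OF \<open>y \<in> V\<close> \<open>y \<in> V\<close>]] that V\<^sub>1(1) \<phi>' im by blast
  qed
  then have "\<Psi> ` jet \<pi> r \<phi> ` V\<^sub>1 = jet \<pi>' r \<phi>' ` proj \<pi>' ` \<Phi>\<^sub>0 ` \<phi> ` V\<^sub>1"
    by (simp add: image_image)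
  also have "proj \<pi>' ` \<Phi>\<^sub>0 ` \<phi> ` V\<^sub>1 = V'"
    using \<phi>' unfolding im by (force simp: local_section_def)
  finally show thesis
    using that V\<^sub>0 V\<^sub>1 \<phi>' by blast
qed

theorem proposition12p9:
  fixes \<pi> :: "('q, 'e) fibred" and \<pi>' :: "('p, 'f) fibred" and r :: nat
    and U S :: "('q, 'e) jet set" and U' :: "('p, 'f) jet set"
    and \<Phi> :: "('q, 'e) jet \<Rightarrow> ('p, 'f) jet"
  assumes "fibred_manifold \<pi>" and "fibred_manifold \<pi>'"
    and "base_dim \<pi> = base_dim \<pi>'" and "fibre_dim \<pi> = fibre_dim \<pi>'" and "r \<ge> 1"
    and "hodograph_contact \<pi> \<pi>' r U U' \<Phi>"
    and "S \<subseteq> U" and "holonomic \<pi> r S"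
    and "transverse (jet_bundle \<pi>' r) (base \<pi>') jet_proj (base_dim \<pi>') (\<Phi> ` S)"
  shows "holonomic \<pi>' r (\<Phi> ` S)"
proof (rule holonomicI)
  show "fibred_manifold \<pi>'" by fact
  show "submanifold (jet_bundle \<pi>' r) (base_dim \<pi>') (\<Phi> ` S)"
    using assms(9) by (simp add: transverse_def)
  fix p' assume "p' \<in> \<Phi> ` S"
  then obtain p where p: "p \<in> S" "p' = \<Phi> p" by blast
  obtain N W \<Phi>\<^sub>0 where N: "openin (mtop (jet_bundle \<pi> r)) N" "p \<in> N"
    and hod: "hodograph_type \<pi> \<pi>' W \<Phi>\<^sub>0" "hodograph_prolongation_on \<pi> \<pi>' r W \<Phi>\<^sub>0 N \<Phi>"
    using assms(6,7) p(1) unfolding hodograph_contact_def by blast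
  obtain G V \<phi> where "p \<in> G" and \<phi>: "local_section \<pi> V \<phi>" and SG: "S \<inter> G = jet \<pi> r \<phi> ` V"
    using assms(8) p(1) unfolding holonomic_def by blast
  then obtain x where x: "x \<in> V" "p = jet \<pi> r \<phi> x"
    using p(1) by blast
  have "S \<subseteq> topspace (mtop (jet_bundle \<pi> r))"
    using assms(8) by (simp add: holonomic_def submanifold_def)
  then have cont: "continuous_map (subtopology (mtop (base \<pi>)) V) (mtop (jet_bundle \<pi> r)) (jet \<pi> r \<phi>)"
    using continuous_map_jet[OF assms(1) \<phi>] SG by blast
  have V: "openin (mtop (base \<pi>)) V"
    using \<phi> by (simp add: local_section_def smooth_on_def)
  \<comment> \<open>\<open>\<Phi>\<close> is the prolongation of \<open>\<Phi>\<^sub>0\<close> only on \<open>N\<close>, so \<open>\<phi>\<close> is restricted to the points with jets in \<open>N\<close>.\<close>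
  define V\<^sub>N where "V\<^sub>N = {y \<in> V. jet \<pi> r \<phi> y \<in> N}"
  have "openin (subtopology (mtop (base \<pi>)) V) V\<^sub>N"
    using openin_continuous_map_preimage[OF cont N(1)] openin_subset[OF V]
    by (simp add: V\<^sub>N_def inf_absorb2)
  then have "openin (mtop (base \<pi>)) V\<^sub>N"
    using V openin_trans_full by blast
  then have "local_section \<pi> V\<^sub>N \<phi>"
    using \<phi> local_section_subset by (auto simp: V\<^sub>N_def)
  moreover have "x \<in> V\<^sub>N" "jet \<pi> r \<phi> ` V\<^sub>N \<subseteq> N"
    using x N(2) by (auto simp: V\<^sub>N_def)
  ultimately obtain V\<^sub>1 V' \<phi>' where V\<^sub>1: "x \<in> V\<^sub>1" "V\<^sub>1 \<subseteq> V\<^sub>N" and \<phi>': "local_section \<pi>' V' \<phi>'"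
    and im: "\<Phi> ` jet \<pi> r \<phi> ` V\<^sub>1 = jet \<pi>' r \<phi>' ` V'"
    using hodograph_prolongation_image[OF hod] by metis
  have "p' \<in> jet \<pi>' r \<phi>' ` V'"
    using im x V\<^sub>1(1) p(2) by blast
  moreover have "jet \<pi>' r \<phi>' ` V' \<subseteq> \<Phi> ` S"
    unfolding im[symmetric] using SG V\<^sub>1(2) unfolding V\<^sub>N_def by blast
  ultimately show "\<exists>V \<phi>. local_section \<pi>' V \<phi> \<and> p' \<in> jet \<pi>' r \<phi> ` V \<and> jet \<pi>' r \<phi> ` V \<subseteq> \<Phi> ` S"
    using \<phi>' by blast
qed

end
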